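(* Let $w\ge1$ and let $\mathsf{T}[\mathbf{W}^{(1)}_{w_1,x}]$ be the $qq$-character of the $A_1$ quiver of weight $w$ specialized at spectral parameters $(x,xq_1,\dots,xq_1^{w-1})$. Its classical limits are the degenerated $q$-character and the weight $w$ $q$-character: $$\lim_{q_1\to1}\mathsf{T}[\mathbf{W}^{(1)}_{w_1,x}]=\sum_{v=0}^{w}\binom{w}{v}(\mathsf{Y}_x)^{w-v}(\mathsf{Y}_{x;0,1})^{-v}=\bigl(\mathsf{Y}_x+\mathsf{Y}_{x;0,1}^{-1}\bigr)^w,$$ $$\lim_{q_2\to1}\mathsf{T}[\mathbf{W}^{(1)}_{w_1,x}]=\sum_{v=0}^{w}\ \prod_{i=1}^{w-v}\mathsf{Y}_{x;i-1,0}\prod_{j=w-v+1}^{w}\mathsf{Y}_{x;j,0}^{-1}.$$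
   Context: Let $q_1,q_2\in\mathbb{C}^\times$ be generic and $q=q_1q_2$. Define $\mathscr{S}(z)=\dfrac{(1-z/q_1)(1-z/q_2)}{(1-z)(1-z/(q_1q_2))}$. Let $\mathsf{Y}_x$ ($x\in\mathbb{C}^\times$) be commuting invertible variables depending continuously on the argument $x$; write $\mathsf{Y}_{x;j,k}=\mathsf{Y}_{xq_1^jq_2^k}$. The $qq$-character of the $A_1$ quiver of weight $w$ with generic spectral parameters $(x_1,\dots,x_w)$ is $$\mathsf{T}_{w,(x_1,\dots,x_w)}=\sum_{I\sqcup J=\{1,\dots,w\}}\ \prod_{i\in I,\,j\in J}\mathscr{S}\Bigl(\frac{x_i}{x_j}\Bigr)\prod_{i\in I}\mathsf{Y}_{x_i}\prod_{j\in J}\mathsf{Y}_{x_jq}^{-1},$$ and $\mathsf{T}[\mathbf{W}^{(1)}_{w_1,x}]$ is its specialization at $(x_1,\dots,x_w)=(x,xq_1,\dots,xq_1^{w-1})$. In the limit $q_1\to1$ the parameter $q_2$ is kept fixed and generic, and in the limit $q_2\to1$ the parameter $q_1$ is kept fixed and generic; the limit is taken in the coefficients and in the arguments of the $\mathsf{Y}$-variables. *)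

theory Defs
  imports Complex_Main
begin

text \<open>
  The \<open>Y\<close>-variables live in an arbitrary commutative Hausdorff topological algebra over the
  complex numbers, with structure map \<open>\<iota>\<close>. The inverse variables \<open>Yi x\<close> are a separate function,
  because inversion need not be continuous in a topological ring: both \<open>Y\<close> and \<open>Yi\<close> are to depend
  continuously on the argument. Nothing else is assumed about the \<open>Y x\<close>, so the Laurent polynomial
  ring in independent variables, with any topology for which its operations and the variables are
  continuous, is covered, and so is every continuous nonvanishing numerical evaluation of them.
\<close>

locale Y_variables =
  fixes \<iota> :: "complex \<Rightarrow> 'a :: {comm_ring_1, topological_ab_group_add,
                               topological_semigroup_mult, t2_space}"
    and Y Yi :: "complex \<Rightarrow> 'a"
  assumes scalar_add: "\<iota> (a + b) = \<iota> a + \<iota> b"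
    and scalar_mult: "\<iota> (a * b) = \<iota> a * \<iota> b"
    and scalar_one: "\<iota> 1 = 1"
    and continuous_scalar: "continuous_on UNIV \<iota>"
    and Y_inverse: "x \<noteq> 0 \<Longrightarrow> Y x * Yi x = 1"
    and continuous_Y: "continuous_on (- {0}) Y"
    and continuous_Yi: "continuous_on (- {0}) Yi"

text \<open>The condition that genericity of the pair \<open>(q\<^sub>1, q\<^sub>2)\<close> imposes on a single parameter.\<close>

definition generic_parameter :: "complex \<Rightarrow> bool" where
  "generic_parameter q \<longleftrightarrow> q \<noteq> 0 \<and> (\<forall>n::nat. n > 0 \<longrightarrow> q ^ n \<noteq> 1)"

definition S_factor :: "complex \<Rightarrow> complex \<Rightarrow> complex \<Rightarrow> complex" where
  "S_factor q1 q2 z = ((1 - z / q1) * (1 - z / q2)) / ((1 - z) * (1 - z / (q1 * q2)))"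

definition qq_character ::
  "(complex \<Rightarrow> 'a::comm_ring_1) \<Rightarrow> (complex \<Rightarrow> 'a) \<Rightarrow> (complex \<Rightarrow> 'a) \<Rightarrow>
   complex \<Rightarrow> complex \<Rightarrow> nat \<Rightarrow> (nat \<Rightarrow> complex) \<Rightarrow> 'a" where
  "qq_character \<iota> Y Yi q1 q2 w xs =
     (\<Sum>(I, J) | I \<union> J = {1..w} \<and> I \<inter> J = {}.
        \<iota> (\<Prod>i\<in>I. \<Prod>j\<in>J. S_factor q1 q2 (xs i / xs j))
          * (\<Prod>i\<in>I. Y (xs i)) * (\<Prod>j\<in>J. Yi (xs j * (q1 * q2))))"

text \<open>
  At these spectral parameters the arguments of \<open>S_factor\<close> are \<open>q1\<close> to a nonzero power between
  \<open>-w\<close> and \<open>w\<close>. For generic \<open>q1\<close>, \<open>q2\<close> this is not a pole of \<open>S_factor\<close>, so specialization is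
  plain substitution.
\<close>

definition qq_character_W1 ::
  "(complex \<Rightarrow> 'a::comm_ring_1) \<Rightarrow> (complex \<Rightarrow> 'a) \<Rightarrow> (complex \<Rightarrow> 'a) \<Rightarrow>
   complex \<Rightarrow> complex \<Rightarrow> nat \<Rightarrow> complex \<Rightarrow> 'a" where
  "qq_character_W1 \<iota> Y Yi q1 q2 w x = qq_character \<iota> Y Yi q1 q2 w (\<lambda>i. x * q1 ^ (i - 1))"

text \<open>The variable usually written with indices \<open>x; j, k\<close>.\<close>

definition shifted :: "(complex \<Rightarrow> 'a) \<Rightarrow> complex \<Rightarrow> complex \<Rightarrow> complex \<Rightarrow> nat \<Rightarrow> nat \<Rightarrow> 'a" where
  "shifted Y q1 q2 x j k = Y (x * q1 ^ j * q2 ^ k)"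

end

theory Submission imports Defs begin

text \<open>
  At \<open>x\<^sub>i = x q\<^sub>1\<^sup>i\<^sup>-\<^sup>1\<close> the factor \<open>S_factor q1 q2 (x\<^sub>i / x\<^sub>j)\<close> with \<open>i = j + 1\<close>
  vanishes, so only the \<open>w + 1\<close> terms in which \<open>I\<close> is an initial segment of \<open>{1..w}\<close> survive.
  The remaining factors have \<open>i < j\<close>. They tend to \<open>1\<close> as \<open>q\<^sub>2 \<rightarrow> 1\<close>, and to
  \<open>(j - i + 1) / (j - i)\<close> as \<open>q\<^sub>1 \<rightarrow> 1\<close>; the product of the latter telescopes in \<open>j\<close> to a
  binomial coefficient.
\<close>

section \<open>Collapse of the sum over splittings to \<open>w + 1\<close> terms\<close>

text \<open>The condition on \<open>J\<close> makes membership in \<open>I\<close> pass from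
  \<open>Suc n\<close> down to \<open>n\<close> for \<open>n \<ge> 1\<close>, so \<open>I\<close>
  contains everything up to its maximum.\<close>

lemma split_without_descent_is_initial_segment:
  fixes I J :: "nat set"
  assumes "I \<union> J = {1..w}" and "I \<inter> J = {}" and "\<And>j. j \<in> J \<Longrightarrow> Suc j \<notin> I"
  shows "\<exists>a\<le>w. I = {1..a} \<and> J = {a+1..w}"
proof -
  have fin: "finite (insert 0 I)"
    using assms(1) by (metis finite_Un finite_atLeastAtMost finite_insert)
  \<comment> \<open>Inserting 0 covers empty \<open>I\<close>, where \<open>a = 0\<close> and
    \<open>{1..a}\<close> is empty.\<close>
  define a where "a = Max (insert 0 I)"
  have a_in: "a \<in> insert 0 I" and a_max: "\<And>i. i \<in> I \<Longrightarrow> i \<le> a"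
    unfolding a_def using fin Max_in Max_ge by (blast, blast)
  have "a \<le> w" using a_in assms(1) by auto
  have down: "k \<in> I" if "k \<le> a" "1 \<le> k" for k
    using that
  proof (induction rule: inc_induct)
    case base
    then show ?case using a_in by auto
  next
    case (step n)
    then have "n \<notin> J" "n \<in> {1..w}" using assms(3) \<open>a \<le> w\<close> by auto
    then show ?case using assms(1) by blast
  qed
  have I: "I = {1..a}" using down a_max assms(1) by auto
  moreover have "J = {a+1..w}"
  proof -
    have "J = {1..w} - I" using assms(1,2) by blast
    then show ?thesis unfolding I by auto
  qed
  ultimately show ?thesis using \<open>a \<le> w\<close> by blast
qed

text \<open>The numerator factor \<open>1 - z / q1\<close> vanishes at \<open>z = q1\<close>. If the
  denominator vanishes too, the value is still 0 by the convention for division by zero.\<close>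

lemma S_factor_self [simp]: "q1 \<noteq> 0 \<Longrightarrow> S_factor q1 q2 q1 = 0"
  by (simp add: S_factor_def)

lemma power_quotient_eq:
  fixes q :: complex
  assumes "q \<noteq> 0" "1 \<le> i" "i < j"
  shows "q ^ (i - 1) / q ^ (j - 1) = (1 / q) ^ (j - i)"
proof -
  have "j - 1 = (i - 1) + (j - i)" using assms by simp
  then have "q ^ (j - 1) = q ^ (i - 1) * q ^ (j - i)" by (metis power_add)
  then show ?thesis using assms(1) by (simp add: power_one_over)
qed

lemma (in Y_variables) scalar_zero: "\<iota> 0 = 0"
  using scalar_add[of 0 0] by simp

lemma (in Y_variables) scalar_of_nat: "\<iota> (of_nat n) = of_nat n"
  by (induction n) (simp_all add: scalar_zero scalar_add scalar_one)

text \<open>An exact identity, before any limit. Every other splitting has \<open>j\<close> in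
  \<open>J\<close> and \<open>Suc j\<close> in \<open>I\<close>, so that its coefficient contains
  \<open>S_factor q1 q2 q1\<close>. The index \<open>v\<close> is the size of
  \<open>J\<close>.\<close>

lemma (in Y_variables) qq_character_W1_eq:
  assumes "x \<noteq> 0" and "q1 \<noteq> 0"
  shows "qq_character_W1 \<iota> Y Yi q1 q2 w x =
    (\<Sum>v=0..w. \<iota> (\<Prod>i=1..w-v. \<Prod>j=w-v+1..w. S_factor q1 q2 ((1 / q1) ^ (j - i)))
       * (\<Prod>i=1..w-v. Y (x * q1 ^ (i - 1)))
       * (\<Prod>j=w-v+1..w. Yi (x * q1 ^ (j - 1) * (q1 * q2))))"
proof -
  define T where "T = (\<lambda>(I, J).
        \<iota> (\<Prod>i\<in>I. \<Prod>j\<in>J. S_factor q1 q2 (q1 ^ (i - 1) / q1 ^ (j - 1)))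
          * (\<Prod>i\<in>I. Y (x * q1 ^ (i - 1))) * (\<Prod>j\<in>J. Yi (x * q1 ^ (j - 1) * (q1 * q2))))"
  define D :: "(nat set \<times> nat set) set" where "D = {(I, J). I \<union> J = {1..w} \<and> I \<inter> J = {}}"
  define h where "h = (\<lambda>v. ({1..w-v}, {w-v+1..w}))"
  have "D \<subseteq> Pow {1..w} \<times> Pow {1..w}" unfolding D_def by auto
  then have "finite D" by (rule finite_subset) simp
  have "inj_on h {0..w}"
  proof (rule inj_onI)
    fix u v assume "u \<in> {0..w}" "v \<in> {0..w}" "h u = h v"
    moreover from this have "card {1..w-u} = card {1..w-v}" unfolding h_def by (metis prod.inject)
    ultimately show "u = v" by simp
  qed
  have "h ` {0..w} \<subseteq> D"
    unfolding h_def D_def by auto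
  have vanish: "T p = 0" if "p \<in> D - h ` {0..w}" for p
  proof -
    obtain I J where p: "p = (I, J)" by fastforce
    have IJ: "I \<union> J = {1..w}" "I \<inter> J = {}" using that unfolding p D_def by auto
    have "\<not> (\<exists>a\<le>w. I = {1..a} \<and> J = {a+1..w})"
    proof
      assume "\<exists>a\<le>w. I = {1..a} \<and> J = {a+1..w}"
      then obtain a where "a \<le> w" "I = {1..a}" "J = {a+1..w}" by blast
      then have "p = h (w - a)" "w - a \<in> {0..w}" by (auto simp: p h_def)
      then show False using that by blast
    qed
    then obtain j where j: "j \<in> J" "Suc j \<in> I"
      using split_without_descent_is_initial_segment[OF IJ] by blast
    have fin: "finite I" "finite J" using IJ(1) by (metis finite_Un finite_atLeastAtMost)+
    \<comment> \<open>At \<open>j = 0\<close> truncated subtraction would make both exponents 0 and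
      the ratio 1 instead of \<open>q1\<close>.\<close>
    have "1 \<le> j" using j IJ by auto
    then have "q1 ^ (Suc j - 1) / q1 ^ (j - 1) = q1"
      using \<open>q1 \<noteq> 0\<close> by (cases j) auto
    then have "S_factor q1 q2 (q1 ^ (Suc j - 1) / q1 ^ (j - 1)) = 0"
      using \<open>q1 \<noteq> 0\<close> by (metis S_factor_self)
    then have "(\<Prod>k\<in>J. S_factor q1 q2 (q1 ^ (Suc j - 1) / q1 ^ (k - 1))) = 0"
      using fin j by (intro prod_zero) auto
    then have "(\<Prod>i\<in>I. \<Prod>j\<in>J. S_factor q1 q2 (q1 ^ (i - 1) / q1 ^ (j - 1))) = 0"
      by (intro prod_zero[OF fin(1)] bexI[of _ "Suc j"] j(2))
    then show ?thesis unfolding p T_def by (simp add: scalar_zero)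
  qed
  have "qq_character_W1 \<iota> Y Yi q1 q2 w x = sum T D"
    unfolding qq_character_W1_def qq_character_def T_def D_def using \<open>x \<noteq> 0\<close> by simp
  also have "\<dots> = sum T (h ` {0..w})"
    using \<open>finite D\<close> \<open>h ` {0..w} \<subseteq> D\<close> vanish by (intro sum.mono_neutral_right) auto
  also have "\<dots> = (\<Sum>v=0..w. T (h v))"
    using \<open>inj_on h {0..w}\<close> by (simp add: sum.reindex)
  also have "\<dots> = (\<Sum>v=0..w. \<iota> (\<Prod>i=1..w-v. \<Prod>j=w-v+1..w. S_factor q1 q2 ((1 / q1) ^ (j - i)))
       * (\<Prod>i=1..w-v. Y (x * q1 ^ (i - 1)))
       * (\<Prod>j=w-v+1..w. Yi (x * q1 ^ (j - 1) * (q1 * q2))))"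
    unfolding T_def h_def using \<open>q1 \<noteq> 0\<close>
    by (auto intro!: sum.cong prod.cong arg_cong[of _ _ "\<lambda>t. \<iota> t * _ * _"]
        arg_cong[of _ _ "S_factor q1 q2"] power_quotient_eq[simplified])
  finally show ?thesis .
qed

section \<open>Limits of the coefficients\<close>

text \<open>Cancelling \<open>1 - u\<close> leaves geometric sums with \<open>Suc d\<close> and
  \<open>d\<close> terms, and their quotient is continuous at 1.\<close>

lemma tendsto_power_ratio_at_1:
  assumes "d > 0"
  shows "((\<lambda>u::complex. (1 - u ^ Suc d) / (1 - u ^ d)) \<longlongrightarrow> of_nat (Suc d) / of_nat d) (at 1)"
proof -
  have "((\<lambda>u::complex. (\<Sum>i<Suc d. u ^ i) / (\<Sum>i<d. u ^ i))
      \<longlongrightarrow> (\<Sum>i<Suc d. 1 ^ i) / (\<Sum>i<d. 1 ^ i)) (at 1)"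
    using assms by (intro tendsto_intros) auto
  moreover have "\<forall>\<^sub>F u::complex in at 1.
      (\<Sum>i<Suc d. u ^ i) / (\<Sum>i<d. u ^ i) = (1 - u ^ Suc d) / (1 - u ^ d)"
    by (auto simp: eventually_at_filter one_diff_power_eq simp del: power_Suc sum.lessThan_Suc)
  ultimately show ?thesis
    by (auto intro: Lim_transform_eventually)
qed

text \<open>In terms of \<open>u = 1 / q1\<close> the factor splits into the indeterminate quotient
  of the previous lemma and a quotient that tends to 1 because \<open>q2 \<noteq> 1\<close>.\<close>

lemma tendsto_S_factor_q1:
  assumes "generic_parameter q2" and "d > 0"
  shows "((\<lambda>q1. S_factor q1 q2 ((1 / q1) ^ d)) \<longlongrightarrow> of_nat (Suc d) / of_nat d) (at 1)"
proof -
  have q2: "q2 \<noteq> 0" "q2 \<noteq> 1"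
    using assms(1) unfolding generic_parameter_def by (auto dest: spec[of _ 1])
  have inv: "filterlim (\<lambda>q::complex. 1 / q) (at 1) (at 1)"
    unfolding filterlim_at
    by (auto simp: eventually_at_filter intro!: tendsto_eq_intros)
  have "((\<lambda>u::complex. (1 - u ^ Suc d) / (1 - u ^ d) * ((1 - u ^ d / q2) / (1 - u ^ Suc d / q2)))
      \<longlongrightarrow> of_nat (Suc d) / of_nat d * ((1 - 1 ^ d / q2) / (1 - 1 ^ Suc d / q2))) (at 1)"
    using q2 by (intro tendsto_mult tendsto_power_ratio_at_1 assms(2) tendsto_intros) auto
  then have "((\<lambda>u::complex. (1 - u ^ Suc d) / (1 - u ^ d) * ((1 - u ^ d / q2) / (1 - u ^ Suc d / q2)))
      \<longlongrightarrow> of_nat (Suc d) / of_nat d) (at 1)"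
    using q2 by simp
  from filterlim_compose[OF this inv] show ?thesis
    by (simp add: S_factor_def mult.commute)
qed

text \<open>At \<open>q2 = 1\<close> numerator and denominator of \<open>S_factor\<close> coincide;
  genericity of \<open>q1\<close> keeps the denominator nonzero there.\<close>

lemma tendsto_S_factor_q2:
  assumes "generic_parameter q1" and "d > 0"
  shows "((\<lambda>q2. S_factor q1 q2 ((1 / q1) ^ d)) \<longlongrightarrow> 1) (at 1)"
proof -
  have q1: "q1 \<noteq> 0" "q1 ^ d \<noteq> 1" "q1 * q1 ^ d \<noteq> 1"
    using assms unfolding generic_parameter_def
    by (auto dest: spec[of _ "Suc d"])
  then have "(1 / q1) ^ d \<noteq> 1" "(1 / q1) ^ d / q1 \<noteq> 1"
    by (auto simp: field_simps)
  then show ?thesis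
    unfolding S_factor_def using q1(1)
    by (auto intro!: tendsto_eq_intros)
qed

text \<open>For fixed \<open>i\<close> the product over \<open>j\<close> telescopes to
  \<open>(w + 1 - i) / (a + 1 - i)\<close>. The product of these over \<open>i\<close> is the
  product formula for the binomial coefficient, with the index shifted by one.\<close>

lemma prod_ratio_eq_binomial:
  assumes "a \<le> w"
  shows "(\<Prod>i=1..a. \<Prod>j=a+1..w. (of_nat (Suc (j - i)) / of_nat (j - i) :: complex))
    = of_nat (w choose a)"
proof -
  have tele: "(\<Prod>j=a+1..w. (of_nat (Suc (j - i)) / of_nat (j - i) :: complex))
      = of_nat (Suc w - i) / of_nat (Suc a - i)" if "i \<in> {1..a}" for i
    using assms
  proof (induction w rule: dec_induct)
    case base
    have "(of_nat (Suc a - i) :: complex) \<noteq> 0" using that by (subst of_nat_eq_0_iff) auto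
    then show ?case by (simp del: of_nat_diff)
  next
    case (step n)
    have "Suc (Suc n - i) = Suc (Suc n) - i" using that step by auto
    moreover have "(of_nat (Suc n - i) :: complex) \<noteq> 0"
      using that step by (subst of_nat_eq_0_iff) auto
    ultimately show ?case using step by (simp del: of_nat_diff of_nat_Suc)
  qed
  have "(\<Prod>i=1..a. \<Prod>j=a+1..w. (of_nat (Suc (j - i)) / of_nat (j - i) :: complex))
      = (\<Prod>i=1..a. of_nat (Suc w - i) / of_nat (Suc a - i))"
    using tele by (rule prod.cong[OF refl])
  also have "\<dots> = (\<Prod>i=0..<a. of_nat (w - i) / of_nat (a - i))"
    by (rule prod.reindex_bij_witness[of _ Suc "\<lambda>i. i - 1"]) auto
  also have "\<dots> = of_nat (w choose a)"
    using assms by (simp add: binomial_altdef_of_nat)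
  finally show ?thesis .
qed

text \<open>The library's \<open>tendsto_prod'\<close> needs the class \<open>topological_comm_monoid_mult\<close>, to which a
  type of sort \<open>{comm_ring_1, topological_semigroup_mult}\<close> need not be known to belong.\<close>

lemma tendsto_prod_comm_ring:
  fixes f :: "'i \<Rightarrow> 'b \<Rightarrow> 'a::{comm_ring_1, topological_semigroup_mult}"
  assumes "\<And>i. i \<in> I \<Longrightarrow> (f i \<longlongrightarrow> a i) F"
  shows "((\<lambda>t. \<Prod>i\<in>I. f i t) \<longlongrightarrow> (\<Prod>i\<in>I. a i)) F"
  using assms by (induction I rule: infinite_finite_induct) (simp_all add: tendsto_mult)

lemma (in Y_variables) tendsto_scalar: "(f \<longlongrightarrow> c) F \<Longrightarrow> ((\<lambda>t. \<iota> (f t)) \<longlongrightarrow> \<iota> c) F"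
  using continuous_on_tendsto_compose[OF continuous_scalar] by simp

lemma (in Y_variables) tendsto_Y:
  assumes "(f \<longlongrightarrow> c) F" "c \<noteq> 0"
  shows "((\<lambda>t. Y (f t)) \<longlongrightarrow> Y c) F"
  using assms continuous_Y
  by (metis ComplI continuous_on_eq_continuous_at isCont_tendsto_compose open_Compl
      closed_singleton singletonD)

lemma (in Y_variables) tendsto_Yi:
  assumes "(f \<longlongrightarrow> c) F" "c \<noteq> 0"
  shows "((\<lambda>t. Yi (f t)) \<longlongrightarrow> Yi c) F"
  using assms continuous_Yi
  by (metis ComplI continuous_on_eq_continuous_at isCont_tendsto_compose open_Compl
      closed_singleton singletonD)

section \<open>The two classical limits, term by term\<close>

lemma (in Y_variables) tendsto_qq_character_W1_q1:
  assumes "x \<noteq> 0" and gen: "generic_parameter q2"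
  shows "((\<lambda>q1. qq_character_W1 \<iota> Y Yi q1 q2 w x) \<longlongrightarrow>
     (\<Sum>v=0..w. of_nat (w choose v) * Y x ^ (w - v) * shifted Yi 1 q2 x 0 1 ^ v)) (at 1)"
proof -
  \<comment> \<open>This keeps the limiting argument \<open>x * q2\<close> away from 0, so that
    \<open>Yi\<close> is continuous there.\<close>
  have "q2 \<noteq> 0" using gen by (simp add: generic_parameter_def)
  have "((\<lambda>q1. \<Sum>v=0..w. \<iota> (\<Prod>i=1..w-v. \<Prod>j=w-v+1..w. S_factor q1 q2 ((1 / q1) ^ (j - i)))
       * (\<Prod>i=1..w-v. Y (x * q1 ^ (i - 1)))
       * (\<Prod>j=w-v+1..w. Yi (x * q1 ^ (j - 1) * (q1 * q2)))) \<longlongrightarrow>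
     (\<Sum>v=0..w. \<iota> (\<Prod>i=1..w-v. \<Prod>j=w-v+1..w. of_nat (Suc (j - i)) / of_nat (j - i))
       * (\<Prod>i=1..w-v. Y (x * 1 ^ (i - 1)))
       * (\<Prod>j=w-v+1..w. Yi (x * 1 ^ (j - 1) * (1 * q2))))) (at 1)"
    using assms \<open>q2 \<noteq> 0\<close>
    by (intro tendsto_sum tendsto_mult[where 'a='a] tendsto_prod tendsto_prod_comm_ring tendsto_scalar tendsto_Y tendsto_Yi
        tendsto_S_factor_q1[OF gen] tendsto_intros) auto
  moreover have "(\<Sum>v=0..w. \<iota> (\<Prod>i=1..w-v. \<Prod>j=w-v+1..w. of_nat (Suc (j - i)) / of_nat (j - i))
       * (\<Prod>i=1..w-v. Y (x * 1 ^ (i - 1)))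
       * (\<Prod>j=w-v+1..w. Yi (x * 1 ^ (j - 1) * (1 * q2))))
     = (\<Sum>v=0..w. of_nat (w choose v) * Y x ^ (w - v) * shifted Yi 1 q2 x 0 1 ^ v)"
  proof (rule sum.cong[OF refl])
    fix v assume "v \<in> {0..w}"
    \<comment> \<open>The product formula yields the coefficient indexed by the size
      \<open>w - v\<close> of \<open>I\<close>.\<close>
    then have "w choose (w - v) = w choose v" using binomial_symmetric[of v w] by simp
    then show "\<iota> (\<Prod>i=1..w-v. \<Prod>j=w-v+1..w. of_nat (Suc (j - i)) / of_nat (j - i))
       * (\<Prod>i=1..w-v. Y (x * 1 ^ (i - 1)))
       * (\<Prod>j=w-v+1..w. Yi (x * 1 ^ (j - 1) * (1 * q2)))
      = of_nat (w choose v) * Y x ^ (w - v) * shifted Yi 1 q2 x 0 1 ^ v"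
      unfolding prod_ratio_eq_binomial[OF diff_le_self] scalar_of_nat
      using \<open>v \<in> {0..w}\<close> by (simp add: shifted_def)
  qed
  \<comment> \<open>The collapsed formula holds only for \<open>q1 \<noteq> 0\<close>, hence near
    1.\<close>
  moreover have "\<forall>\<^sub>F q1::complex in at 1. q1 \<noteq> 0"
    by (rule tendsto_imp_eventually_ne[OF tendsto_ident_at]) simp
  ultimately show ?thesis
    by (auto elim!: Lim_transform_eventually eventually_mono
        simp: qq_character_W1_eq[OF \<open>x \<noteq> 0\<close>])
qed

lemma (in Y_variables) tendsto_qq_character_W1_q2:
  assumes "x \<noteq> 0" and gen: "generic_parameter q1"
  shows "((\<lambda>q2. qq_character_W1 \<iota> Y Yi q1 q2 w x) \<longlongrightarrow>
     (\<Sum>v=0..w. (\<Prod>i=1..w-v. shifted Y q1 1 x (i - 1) 0)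
                * (\<Prod>j=w-v+1..w. shifted Yi q1 1 x j 0))) (at 1)"
proof -
  have "q1 \<noteq> 0" using gen by (simp add: generic_parameter_def)
  have "((\<lambda>q2. \<Sum>v=0..w. \<iota> (\<Prod>i=1..w-v. \<Prod>j=w-v+1..w. S_factor q1 q2 ((1 / q1) ^ (j - i)))
       * (\<Prod>i=1..w-v. Y (x * q1 ^ (i - 1)))
       * (\<Prod>j=w-v+1..w. Yi (x * q1 ^ (j - 1) * (q1 * q2)))) \<longlongrightarrow>
     (\<Sum>v=0..w. \<iota> (\<Prod>i=1..w-v. \<Prod>j=w-v+1..w. 1)
       * (\<Prod>i=1..w-v. Y (x * q1 ^ (i - 1)))
       * (\<Prod>j=w-v+1..w. Yi (x * q1 ^ (j - 1) * (q1 * 1))))) (at 1)"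
    using assms \<open>q1 \<noteq> 0\<close>
    by (intro tendsto_sum tendsto_mult[where 'a='a] tendsto_prod tendsto_prod_comm_ring tendsto_scalar tendsto_Y tendsto_Yi
        tendsto_S_factor_q2[OF gen] tendsto_intros) auto
  moreover have "(\<Sum>v=0..w. \<iota> (\<Prod>i=1..w-v. \<Prod>j=w-v+1..w. 1)
       * (\<Prod>i=1..w-v. Y (x * q1 ^ (i - 1)))
       * (\<Prod>j=w-v+1..w. Yi (x * q1 ^ (j - 1) * (q1 * 1))))
     = (\<Sum>v=0..w. (\<Prod>i=1..w-v. shifted Y q1 1 x (i - 1) 0)
                * (\<Prod>j=w-v+1..w. shifted Yi q1 1 x j 0))"
  proof -
    \<comment> \<open>The shift by \<open>q1 * q2\<close> raises the exponent \<open>j - 1\<close>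
      to \<open>j\<close> once \<open>q2 = 1\<close>; truncated subtraction requires
      \<open>j \<ge> 1\<close>.\<close>
    have "q1 ^ (j - Suc 0) * q1 = q1 ^ j" if "Suc n \<le> j" for n j
      using that by (cases j) auto
    then show ?thesis
      by (auto simp: scalar_one shifted_def mult.assoc intro!: sum.cong prod.cong arg_cong2[of _ _ _ _ "(*)"])
  qed
  ultimately show ?thesis
    by (simp only: qq_character_W1_eq[OF \<open>x \<noteq> 0\<close> \<open>q1 \<noteq> 0\<close>])
qed

theorem theorem3p5:
  fixes \<iota> :: "complex \<Rightarrow> 'a :: {comm_ring_1, topological_ab_group_add,
                               topological_semigroup_mult, t2_space}"
    and Y Yi :: "complex \<Rightarrow> 'a"
    and w :: nat and x :: complex
  assumes "Y_variables \<iota> Y Yi"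
    and "w \<ge> 1" and "x \<noteq> 0"
  shows "(\<forall>q2. generic_parameter q2 \<longrightarrow>
            ((\<lambda>q1. qq_character_W1 \<iota> Y Yi q1 q2 w x) \<longlongrightarrow>
               (\<Sum>v=0..w. of_nat (w choose v) * Y x ^ (w - v) * shifted Yi 1 q2 x 0 1 ^ v)) (at 1)
          \<and> (\<Sum>v=0..w. of_nat (w choose v) * Y x ^ (w - v) * shifted Yi 1 q2 x 0 1 ^ v)
              = (Y x + shifted Yi 1 q2 x 0 1) ^ w)
       \<and> (\<forall>q1. generic_parameter q1 \<longrightarrow>
            ((\<lambda>q2. qq_character_W1 \<iota> Y Yi q1 q2 w x) \<longlongrightarrow>
               (\<Sum>v=0..w. (\<Prod>i=1..w-v. shifted Y q1 1 x (i - 1) 0)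
                        * (\<Prod>j=w-v+1..w. shifted Yi q1 1 x j 0))) (at 1))"
proof -
  interpret Y_variables \<iota> Y Yi by (fact assms(1))
  \<comment> \<open>The summands are swapped below because \<open>binomial_ring\<close> attaches the
    summation index to the first one.\<close>
  have "(\<Sum>v=0..w. of_nat (w choose v) * Y x ^ (w - v) * b ^ v) = (Y x + b) ^ w" for b
    unfolding add.commute[of "Y x"] binomial_ring atLeast0AtMost
    by (simp add: ac_simps)
  then show ?thesis
    using tendsto_qq_character_W1_q1 tendsto_qq_character_W1_q2 \<open>x \<noteq> 0\<close> by blast
qed

end
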